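(* There exist an instance $G$ of the battery charging game and a price profile $\mathbf{p}\in\mathbb{R}^{[T]}$ (where $T$ is the number of time steps of $G$) such that no strategy profile is a Nash equilibrium for $\mathbf{p}$.
   Context: **Battery charging game.** An instance consists of: a number of time steps $T\in\mathbb{N}$, with $[T]=\{1,\dots,T\}$; a finite directed graph $H=(V,E)$; for each $t\in[T]$ a copy $H_t=(V_t,E_t)$ of $H$ (the copy of $v\in V$ is $v_t$); a capacity $\kappa(e_t)\ge 0$ for each $e_t\in E_t$; a value $d(v_t)\in\mathbb{R}$ for each $v_t\in V_t$ (positive: supply, negative: demand); a finite set $B$ of battery agents, each $b\in B$ having a location $v^b\in V$, battery nodes $b_1,\dots,b_T$, and battery edges $(b_t,b_{t+1})$, $t\in[T-1]$, with capacities $\kappa((b_t,b_{t+1}))\ge 0$. For each $b,t$ there are two transaction edges $(b_t,v^b_t)$ and $(v^b_t,b_t)$ (with infinite capacity under $\kappa$). The graph $G$ is the union of all $H_t$, all battery nodes, battery edges and transaction edges. In addition there is a source $x$ with edges $(x,v_t)$ of capacity $\max(0,d(v_t))$ and a target $y$ with edges $(v_t,y)$ of capacity $\max(0,-d(v_t))$, for all $v_t\in V_t$, $t\in[T]$. **Strategies.** A strategy of agent $b$ is a vector $s_b=(s_{b,t})_{t\in[T]}\in\mathbb{R}^{[T]}$ (positive entries: charging, negative: discharging) with $0\le\sum_{z=1}^t s_{b,z}\le\kappa((b_t,b_{t+1}))$ for each $t\in[T-1]$. A strategy profile $\mathbf{s}$ consists of one strategy per agent. **Flow.** Given $\mathbf{s}$,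 $\kappa_{\mathbf{s}}$ is defined by $\kappa_{\mathbf{s}}((v^b_t,b_t))=\max(0,s_{b,t})$, $\kappa_{\mathbf{s}}((b_t,v^b_t))=\max(0,-s_{b,t})$, and $\kappa_{\mathbf{s}}=\kappa$ on all other edges; $G_{\mathbf{s}}$ is the graph $G$ (with $x,y$) with capacities $\kappa_{\mathbf{s}}$. Flows are (real-valued) feasible $x$-$y$-flows, the value $|f|$ being the flow out of $x$; a maximum flow is one of maximum value. **Admissibility.** A transaction edge $e$ is admissible for $\mathbf{s}$ if every maximum flow $f$ in $G_{\mathbf{s}}$ saturates it, i.e. $f(e)=\kappa_{\mathbf{s}}(e)$. A strategy $s_b$ is admissible for $\mathbf{s}$ if all transaction edges of agent $b$ are admissible; $\mathbf{s}$ is admissible if all its strategies are. **Utilities.** For a price profile $\mathbf{p}=(p_t)_{t\in[T]}\in\mathbb{R}^{[T]}$, $u_b(\mathbf{s},\mathbf{p})=-\infty$ if $s_b$ is not admissible for $\mathbf{s}$, and $u_b(\mathbf{s},\mathbf{p})=-\sum_{t\in[T]}s_{b,t}p_t$ otherwise. **Nash equilibrium.** $\mathbf{s}$ is a (pure) Nash equilibrium for $\mathbf{p}$ if there is no agent $b$ with a strategy $s'_b$ such that $u_b((s'_b,\mathbf{s}_{-b}),\mathbf{p})>u_b(\mathbf{s},\mathbf{p})$. *)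

theory Defs
  imports
    "HOL-Library.Extended_Real"
    "Graph_Theory.Pair_Digraph"
begin

section \<open>Flows in finite digraphs\<close>

definition is_flow ::
  "'a pair_pre_digraph \<Rightarrow> ('a \<times> 'a \<Rightarrow> real) \<Rightarrow> 'a \<Rightarrow> 'a \<Rightarrow> ('a \<times> 'a \<Rightarrow> real) \<Rightarrow> bool" where
  "is_flow G c x y f \<longleftrightarrow>
     (\<forall>e\<in>parcs G. 0 \<le> f e \<and> f e \<le> c e) \<and>
     (\<forall>v\<in>pverts G - {x, y}. sum f (in_arcs G v) = sum f (out_arcs G v))"

text \<open>No edge enters the source in the networks below, so the value need not subtract inflow.\<close>

definition flow_value :: "'a pair_pre_digraph \<Rightarrow> 'a \<Rightarrow> ('a \<times> 'a \<Rightarrow> real) \<Rightarrow> real" where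
  "flow_value G x f = sum f (out_arcs G x)"

definition is_max_flow ::
  "'a pair_pre_digraph \<Rightarrow> ('a \<times> 'a \<Rightarrow> real) \<Rightarrow> 'a \<Rightarrow> 'a \<Rightarrow> ('a \<times> 'a \<Rightarrow> real) \<Rightarrow> bool" where
  "is_max_flow G c x y f \<longleftrightarrow>
     is_flow G c x y f \<and> (\<forall>g. is_flow G c x y g \<longrightarrow> flow_value G x g \<le> flow_value G x f)"


section \<open>The battery charging game\<close>

text \<open>
  Time steps are \<open>1, \<dots>, T\<close>. All functions of a time step, an edge, a vertex or an agent are
  total; only their values on the time steps, edges, vertices and agents of the instance are
  ever used. \<open>battery_cap I b t\<close> is the capacity of the battery edge from step \<open>t\<close> to
  step \<open>t + 1\<close>.
\<close>

record ('v, 'b) battery_instance =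
  horizon :: nat
  grid :: "'v pair_pre_digraph"
  grid_cap :: "nat \<Rightarrow> 'v \<times> 'v \<Rightarrow> real"
  net_supply :: "nat \<Rightarrow> 'v \<Rightarrow> real"
  agents :: "'b set"
  location :: "'b \<Rightarrow> 'v"
  battery_cap :: "'b \<Rightarrow> nat \<Rightarrow> real"

definition battery_game :: "('v, 'b) battery_instance \<Rightarrow> bool" where
  "battery_game I \<longleftrightarrow>
     pair_fin_digraph (grid I) \<and>
     (\<forall>t\<in>{1..horizon I}. \<forall>e\<in>parcs (grid I). 0 \<le> grid_cap I t e) \<and>
     finite (agents I) \<and>
     (\<forall>b\<in>agents I. location I b \<in> pverts (grid I)) \<and>
     (\<forall>b\<in>agents I. \<forall>t\<in>{1..<horizon I}. 0 \<le> battery_cap I b t)"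

datatype ('v, 'b) node = Grid nat 'v | Battery 'b nat | Source | Target

definition charge_edge ::
  "('v, 'b) battery_instance \<Rightarrow> 'b \<Rightarrow> nat \<Rightarrow> ('v, 'b) node \<times> ('v, 'b) node" where
  "charge_edge I b t = (Grid t (location I b), Battery b t)"

definition discharge_edge ::
  "('v, 'b) battery_instance \<Rightarrow> 'b \<Rightarrow> nat \<Rightarrow> ('v, 'b) node \<times> ('v, 'b) node" where
  "discharge_edge I b t = (Battery b t, Grid t (location I b))"

definition transaction_edges ::
  "('v, 'b) battery_instance \<Rightarrow> 'b \<Rightarrow> (('v, 'b) node \<times> ('v, 'b) node) set" where
  "transaction_edges I b =
     (\<Union>t\<in>{1..horizon I}. {charge_edge I b t, discharge_edge I b t})"

definition network :: "('v, 'b) battery_instance \<Rightarrow> ('v, 'b) node pair_pre_digraph" where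
  "network I = \<lparr>
     pverts =
       {Grid t v | t v. t \<in> {1..horizon I} \<and> v \<in> pverts (grid I)} \<union>
       {Battery b t | b t. b \<in> agents I \<and> t \<in> {1..horizon I}} \<union>
       {Source, Target},
     parcs =
       {(Grid t u, Grid t v) | t u v. t \<in> {1..horizon I} \<and> (u, v) \<in> parcs (grid I)} \<union>
       {(Battery b t, Battery b (Suc t)) | b t. b \<in> agents I \<and> t \<in> {1..<horizon I}} \<union>
       (\<Union>b\<in>agents I. transaction_edges I b) \<union>
       {(Source, Grid t v) | t v. t \<in> {1..horizon I} \<and> v \<in> pverts (grid I)} \<union>
       {(Grid t v, Target) | t v. t \<in> {1..horizon I} \<and> v \<in> pverts (grid I)} \<rparr>"

text \<open>
  A profile \<open>s\<close> assigns to agent \<open>b\<close> and step \<open>t\<close> the amount \<open>s b t\<close>, positive when charging.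
  The prefix sums are constrained only before the last step.
\<close>

definition strategy :: "('v, 'b) battery_instance \<Rightarrow> 'b \<Rightarrow> (nat \<Rightarrow> real) \<Rightarrow> bool" where
  "strategy I b sb \<longleftrightarrow>
     (\<forall>t\<in>{1..<horizon I}. 0 \<le> (\<Sum>z=1..t. sb z) \<and> (\<Sum>z=1..t. sb z) \<le> battery_cap I b t)"

definition strategy_profile :: "('v, 'b) battery_instance \<Rightarrow> ('b \<Rightarrow> nat \<Rightarrow> real) \<Rightarrow> bool" where
  "strategy_profile I s \<longleftrightarrow> (\<forall>b\<in>agents I. strategy I b (s b))"

text \<open>
  These are the capacities after the profile has been imposed. The profile replaces the
  capacity (infinite beforehand) of every transaction edge, so all values are real.
  The last equation only concerns pairs that are not edges of the network.
\<close>

fun capacity ::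
  "('v, 'b) battery_instance \<Rightarrow> ('b \<Rightarrow> nat \<Rightarrow> real) \<Rightarrow>
   ('v, 'b) node \<times> ('v, 'b) node \<Rightarrow> real" where
  "capacity I s (Grid t u, Grid _ v) = grid_cap I t (u, v)"
| "capacity I s (Battery b t, Battery _ _) = battery_cap I b t"
| "capacity I s (Grid _ _, Battery b t) = max 0 (s b t)"
| "capacity I s (Battery b t, Grid _ _) = max 0 (- s b t)"
| "capacity I s (Source, Grid t v) = max 0 (net_supply I t v)"
| "capacity I s (Grid t v, Target) = max 0 (- net_supply I t v)"
| "capacity I s _ = 0"

definition admissible_edge ::
  "('v, 'b) battery_instance \<Rightarrow> ('b \<Rightarrow> nat \<Rightarrow> real) \<Rightarrow>
   ('v, 'b) node \<times> ('v, 'b) node \<Rightarrow> bool" where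
  "admissible_edge I s e \<longleftrightarrow>
     (\<forall>f. is_max_flow (network I) (capacity I s) Source Target f \<longrightarrow> f e = capacity I s e)"

definition admissible :: "('v, 'b) battery_instance \<Rightarrow> ('b \<Rightarrow> nat \<Rightarrow> real) \<Rightarrow> 'b \<Rightarrow> bool" where
  "admissible I s b \<longleftrightarrow> (\<forall>e\<in>transaction_edges I b. admissible_edge I s e)"

definition utility ::
  "('v, 'b) battery_instance \<Rightarrow> (nat \<Rightarrow> real) \<Rightarrow> ('b \<Rightarrow> nat \<Rightarrow> real) \<Rightarrow> 'b \<Rightarrow> ereal" where
  "utility I p s b =
     (if admissible I s b then ereal (- (\<Sum>t=1..horizon I. s b t * p t)) else - \<infinity>)"

definition nash_equilibrium ::
  "('v, 'b) battery_instance \<Rightarrow> (nat \<Rightarrow> real) \<Rightarrow> ('b \<Rightarrow> nat \<Rightarrow> real) \<Rightarrow> bool" where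
  "nash_equilibrium I p s \<longleftrightarrow>
     \<not> (\<exists>b\<in>agents I. \<exists>sb. strategy I b sb \<and> utility I p (s(b := sb)) b > utility I p s b)"

end

theory Submission
  imports Defs "HOL-Analysis.Function_Topology"
begin

text \<open>
  One grid vertex, four time steps, supply 1 at steps 1 and 3, demand 1 at steps 2 and 4, and two
  agents with batteries of capacity 1, facing the prices \<open>0, 4, 6, 5\<close>.
  Carrying energy from step 1 to step 4 earns 5 per unit, but the two agents together can carry
  only one unit that way, so one of them earns at most \<open>5/2\<close>. That agent can switch to the
  strategy \<open>(1, -1, 1, -1)\<close>, which earns 3: used at full capacity it ships two units, whereas
  every unit that the other agent carries from step 1 to step 4 blocks two units of it, so
  every maximum flow displaces the other agent.
  Conversely no equilibrium contains trades at step 2 or 3: trading 3 to 4 loses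
  money, and what is sold at step 2 is better sold at step 4. Relays, in which one agent charges
  what the other discharges in the same step, are never admissible, because a maximum flow can
  bypass them.
\<close>

section \<open>Existence of maximum flows\<close>

text \<open>Weak inequalities and equations between continuous functions cut a closed set out of a
  product of compact intervals. The flow value, a sum of coordinates, is continuous and attains its
  maximum there.\<close>

lemma max_flow_exists:
  assumes fin: "finite (parcs G)" and nonneg: "\<And>e. e \<in> parcs G \<Longrightarrow> 0 \<le> c e"
  obtains f where "is_max_flow G c x y f"
proof -
  \<comment> \<open>Flows are total functions, so the coordinates off the arcs are pinned to 0;
    otherwise the box would not be compact.\<close>
  define K where "K = {f \<in> Pi\<^sub>E UNIV (\<lambda>e. if e \<in> parcs G then {0..c e} else {0}). is_flow G c x y f}"
  have "compactin (product_topology (\<lambda>e. euclidean) UNIV)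
      (Pi\<^sub>E UNIV (\<lambda>e. if e \<in> parcs G then {0..c e} else {0}))"
    by (subst compactin_PiE) auto
  hence box: "compact (Pi\<^sub>E UNIV (\<lambda>e. if e \<in> parcs G then {0..c e} else {0}))"
    by (simp add: euclidean_product_topology)
  have closed_flows: "closed {f. is_flow G c x y f}"
    unfolding is_flow_def Ball_def
    by (intro closed_Collect_conj closed_Collect_all closed_Collect_imp closed_Collect_le
        closed_Collect_eq continuous_intros open_Collect_const
        continuous_on_product_coordinates)
  have "K = Pi\<^sub>E UNIV (\<lambda>e. if e \<in> parcs G then {0..c e} else {0}) \<inter> {f. is_flow G c x y f}"
    by (auto simp: K_def)
  hence "compact K"
    using compact_Int_closed[OF box closed_flows] by simp
  moreover have "(\<lambda>_. 0) \<in> K"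
    using nonneg by (auto simp: K_def is_flow_def)
  moreover have "continuous_on K (flow_value G x)"
    unfolding flow_value_def
    by (intro continuous_intros continuous_on_subset[OF continuous_on_product_coordinates subset_UNIV])
  ultimately obtain f where f: "f \<in> K" "\<And>g. g \<in> K \<Longrightarrow> flow_value G x g \<le> flow_value G x f"
    using continuous_attains_sup[of K "flow_value G x"] by blast
  have "flow_value G x g \<le> flow_value G x f" if g: "is_flow G c x y g" for g
  proof -
    \<comment> \<open>Cutting an arbitrary flow to 0 off the arcs moves it into \<open>K\<close> and
      changes no sum over arcs.\<close>
    define h where "h e = (if e \<in> parcs G then g e else 0)" for e
    have agree: "sum h (in_arcs G v) = sum g (in_arcs G v)" 
      "sum h (out_arcs G v) = sum g (out_arcs G v)" for v
      by (auto simp: h_def in_arcs_def out_arcs_def intro!: sum.cong)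
    have "h \<in> K"
      using g agree by (auto simp: K_def is_flow_def h_def)
    with f(2)[of h] agree show ?thesis
      by (simp add: flow_value_def)
  qed
  with f(1) that show ?thesis
    by (auto simp: K_def is_max_flow_def)
qed

section \<open>Flows of the game as net charges\<close>

definition game :: "(nat, nat) battery_instance" where
  "game = \<lparr> horizon = 4, grid = \<lparr> pverts = {0}, parcs = {} \<rparr>, grid_cap = (\<lambda>_ _. 0),
     net_supply = (\<lambda>t _. if odd t then 1 else - 1), agents = {0, 1}, location = (\<lambda>_. 0),
     battery_cap = (\<lambda>_ _. 1) \<rparr>"

lemma battery_game_game: "battery_game game"
  by (auto simp: battery_game_def game_def pair_fin_digraph_def pair_wf_digraph_def
      pair_fin_digraph_axioms_def)

lemma parcs_network_game:
  "parcs (network game) =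
     (\<lambda>(b, t). (Battery b t, Battery b (Suc t))) ` ({0, 1} \<times> {1..<4}) \<union>
     (\<lambda>(b, t). (Grid t 0, Battery b t)) ` ({0, 1} \<times> {1..4}) \<union>
     (\<lambda>(b, t). (Battery b t, Grid t 0)) ` ({0, 1} \<times> {1..4}) \<union>
     (\<lambda>t. (Source, Grid t 0)) ` {1..4} \<union> (\<lambda>t. (Grid t 0, Target)) ` {1..4}"
  unfolding network_def transaction_edges_def charge_edge_def discharge_edge_def game_def
  by auto

lemma pverts_network_game:
  "pverts (network game) - {Source, Target} =
     (\<lambda>t. Grid t 0) ` {1..4} \<union> (\<lambda>(b, t). Battery b t) ` ({0, 1} \<times> {1..4})"
  unfolding network_def game_def by auto

lemma sum_in_arcs_battery:
  assumes "b \<in> {0, 1}" "t \<in> {1..4}"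
  shows "sum f (in_arcs (network game) (Battery b t)) =
    f (Grid t 0, Battery b t) + (if t = 1 then 0 else f (Battery b (t - 1), Battery b t))"
proof -
  have "in_arcs (network game) (Battery b t) = insert (Grid t 0, Battery b t)
      (if t = 1 then {} else {(Battery b (t - 1), Battery b t)})"
    using assms by (auto simp: in_arcs_def network_def transaction_edges_def charge_edge_def
        discharge_edge_def game_def)
  thus ?thesis by simp
qed

lemma sum_out_arcs_battery:
  assumes "b \<in> {0, 1}" "t \<in> {1..4}"
  shows "sum f (out_arcs (network game) (Battery b t)) =
    f (Battery b t, Grid t 0) + (if t = 4 then 0 else f (Battery b t, Battery b (Suc t)))"
proof -
  have "out_arcs (network game) (Battery b t) = insert (Battery b t, Grid t 0)
      (if t = 4 then {} else {(Battery b t, Battery b (Suc t))})"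
    using assms by (auto simp: out_arcs_def network_def transaction_edges_def charge_edge_def
        discharge_edge_def game_def)
  thus ?thesis by simp
qed

lemma sum_in_arcs_grid:
  assumes "t \<in> {1..4}"
  shows "sum f (in_arcs (network game) (Grid t 0)) =
    f (Source, Grid t 0) + (\<Sum>b\<in>{0, 1}. f (Battery b t, Grid t 0))"
proof -
  have "in_arcs (network game) (Grid t 0) =
      insert (Source, Grid t 0) ((\<lambda>b. (Battery b t, Grid t 0)) ` {0, 1})"
    using assms by (auto simp: in_arcs_def network_def transaction_edges_def charge_edge_def
        discharge_edge_def game_def)
  thus ?thesis by simp
qed

lemma sum_out_arcs_grid:
  assumes "t \<in> {1..4}"
  shows "sum f (out_arcs (network game) (Grid t 0)) =
    f (Grid t 0, Target) + (\<Sum>b\<in>{0, 1}. f (Grid t 0, Battery b t))"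
proof -
  have "out_arcs (network game) (Grid t 0) =
      insert (Grid t 0, Target) ((\<lambda>b. (Grid t 0, Battery b t)) ` {0, 1})"
    using assms by (auto simp: out_arcs_def network_def transaction_edges_def charge_edge_def
        discharge_edge_def game_def)
  thus ?thesis by simp
qed

lemma flow_value_game:
  "flow_value (network game) Source f = (\<Sum>t=1..4. f (Source, Grid t 0))"
proof -
  have "out_arcs (network game) Source = (\<lambda>t. (Source, Grid t 0)) ` {1..4}"
    by (auto simp: out_arcs_def network_def transaction_edges_def charge_edge_def
        discharge_edge_def game_def)
  thus ?thesis
    by (simp add: flow_value_def sum.reindex inj_on_def)
qed

lemma capacity_game:
  "capacity game s (Battery b t, Battery b' t') = 1"
  "capacity game s (Source, Grid t v) = (if odd t then 1 else 0)"
  "capacity game s (Grid t v, Target) = (if odd t then 0 else 1)"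
  "capacity game s (Grid t v, Battery b t') = max 0 (s b t')"
  "capacity game s (Battery b t, Grid t' v) = max 0 (- s b t)"
  by (simp_all add: game_def)

text \<open>
  A flow is determined by the net charges \<open>x t\<close> of agent 0 and \<open>y t\<close> of agent 1;
  \<open>a\<close> and \<open>c\<close> are the strategies that bound them.
\<close>

definition realizable :: "(nat \<Rightarrow> real) \<Rightarrow> (nat \<Rightarrow> real) \<Rightarrow> bool" where
  "realizable a x \<longleftrightarrow>
     (\<forall>t\<in>{1, 2, 3, 4}. min 0 (a t) \<le> x t \<and> x t \<le> max 0 (a t)) \<and>
     0 \<le> x 1 \<and> x 1 \<le> 1 \<and>
     0 \<le> x 1 + x 2 \<and> x 1 + x 2 \<le> 1 \<and>
     0 \<le> x 1 + x 2 + x 3 \<and> x 1 + x 2 + x 3 \<le> 1 \<and>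
     x 1 + x 2 + x 3 + x 4 = 0"

text \<open>Conservation at the grid vertices eliminates the source and target edges: the joint net
  charge is the load of the source edge at odd steps and minus the load of the target edge at even
  steps.\<close>

definition balanced :: "(nat \<Rightarrow> real) \<Rightarrow> (nat \<Rightarrow> real) \<Rightarrow> bool" where
  "balanced x y \<longleftrightarrow>
     0 \<le> x 1 + y 1 \<and> x 1 + y 1 \<le> 1 \<and>
     - 1 \<le> x 2 + y 2 \<and> x 2 + y 2 \<le> 0 \<and>
     0 \<le> x 3 + y 3 \<and> x 3 + y 3 \<le> 1 \<and>
     - 1 \<le> x 4 + y 4 \<and> x 4 + y 4 \<le> 0"

definition feasible :: "(nat \<Rightarrow> real) \<Rightarrow> (nat \<Rightarrow> real) \<Rightarrow> (nat \<Rightarrow> real) \<Rightarrow> (nat \<Rightarrow> real) \<Rightarrow> bool" where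
  "feasible a c x y \<longleftrightarrow> realizable a x \<and> realizable c y \<and> balanced x y"

text \<open>This is the flow value: only odd steps have supply, and all of it must be charged
  because there is no demand at those steps.\<close>

definition throughput :: "(nat \<Rightarrow> real) \<Rightarrow> (nat \<Rightarrow> real) \<Rightarrow> real" where
  "throughput x y = x 1 + y 1 + x 3 + y 3"

text \<open>Taking the difference loses nothing: \<open>max 0 (s b t)\<close> and
  \<open>max 0 (- s b t)\<close> are never both positive, so at most one of the two edges carries
  flow.\<close>

definition net_charge ::
  "((nat, nat) node \<times> (nat, nat) node \<Rightarrow> real) \<Rightarrow> nat \<Rightarrow> nat \<Rightarrow> real" where
  "net_charge f b t = f (Grid t 0, Battery b t) - f (Battery b t, Grid t 0)"

text \<open>The inverse of \<open>net_charge\<close>: battery edges carry the stored amount, and the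
  source and target edges carry what conservation dictates.\<close>

fun flow_of :: "(nat \<Rightarrow> nat \<Rightarrow> real) \<Rightarrow> (nat, nat) node \<times> (nat, nat) node \<Rightarrow> real" where
  "flow_of z (Battery b t, Battery _ _) = (\<Sum>i=1..t. z b i)"
| "flow_of z (Grid _ _, Battery b t) = max 0 (z b t)"
| "flow_of z (Battery b t, Grid _ _) = max 0 (- z b t)"
| "flow_of z (Source, Grid t _) = (if odd t then z 0 t + z 1 t else 0)"
| "flow_of z (Grid t _, Target) = (if odd t then 0 else - z 0 t - z 1 t)"
| "flow_of z _ = 0"

section \<open>Translation between flows and net charges\<close>

lemma times: "{1..4} = {1, 2, 3, 4::nat}" "{1..<4} = {1, 2, 3::nat}"
  by auto

lemma balance_grid:
  assumes "t \<in> {1..4}"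
  shows "sum f (in_arcs (network game) (Grid t 0)) = sum f (out_arcs (network game) (Grid t 0)) \<longleftrightarrow>
    f (Source, Grid t 0) = f (Grid t 0, Target) + (net_charge f 0 t + net_charge f 1 t)"
  unfolding sum_in_arcs_grid[OF assms] sum_out_arcs_grid[OF assms] net_charge_def by auto

text \<open>The two conditionals reflect that no battery edge enters step 1 or leaves step 4. Net
  charges of a flow therefore sum to 0, although the amounts of a strategy need not.\<close>

lemma balance_battery:
  assumes "b \<in> {0, 1}" "t \<in> {1..4}"
  shows "sum f (in_arcs (network game) (Battery b t)) = sum f (out_arcs (network game) (Battery b t)) \<longleftrightarrow>
    net_charge f b t = (if t = 4 then 0 else f (Battery b t, Battery b (Suc t))) -
        (if t = 1 then 0 else f (Battery b (t - 1), Battery b t))"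
  unfolding sum_in_arcs_battery[OF assms] sum_out_arcs_battery[OF assms] net_charge_def by auto

lemma is_flow_game_iff:
  "is_flow (network game) (capacity game s) Source Target f \<longleftrightarrow>
     (\<forall>b\<in>{0, 1}. \<forall>t\<in>{1..<4}. 0 \<le> f (Battery b t, Battery b (Suc t)) \<and>
        f (Battery b t, Battery b (Suc t)) \<le> 1) \<and>
     (\<forall>b\<in>{0, 1}. \<forall>t\<in>{1..4}. 0 \<le> f (Grid t 0, Battery b t) \<and>
        f (Grid t 0, Battery b t) \<le> max 0 (s b t)) \<and>
     (\<forall>b\<in>{0, 1}. \<forall>t\<in>{1..4}. 0 \<le> f (Battery b t, Grid t 0) \<and>
        f (Battery b t, Grid t 0) \<le> max 0 (- s b t)) \<and>
     (\<forall>t\<in>{1..4}. 0 \<le> f (Source, Grid t 0) \<and> f (Source, Grid t 0) \<le> (if odd t then 1 else 0)) \<and>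
     (\<forall>t\<in>{1..4}. 0 \<le> f (Grid t 0, Target) \<and> f (Grid t 0, Target) \<le> (if odd t then 0 else 1)) \<and>
     (\<forall>t\<in>{1..4}. f (Source, Grid t 0) = f (Grid t 0, Target) + (net_charge f 0 t + net_charge f 1 t)) \<and>
     (\<forall>b\<in>{0, 1}. \<forall>t\<in>{1..4}. net_charge f b t =
        (if t = 4 then 0 else f (Battery b t, Battery b (Suc t))) -
        (if t = 1 then 0 else f (Battery b (t - 1), Battery b t)))"
  unfolding is_flow_def parcs_network_game pverts_network_game ball_Un ball_simps(9)
    split_paired_Ball_Sigma prod.case
  by (simp only: balance_grid balance_battery capacity_game conj_assoc cong: ball_cong)

lemma net_charge_flow_of: "net_charge (flow_of z) b t = z b t"
  by (simp add: net_charge_def)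

lemma feasible_net_charge:
  assumes "is_flow (network game) (capacity game s) Source Target f"
  shows "feasible (s 0) (s 1) (net_charge f 0) (net_charge f 1)"
    and "flow_value (network game) Source f = throughput (net_charge f 0) (net_charge f 1)"
proof -
  have bounds: "min 0 (s b t) \<le> net_charge f b t \<and> net_charge f b t \<le> max 0 (s b t)"
    if "b \<in> {0, 1}" "t \<in> {1, 2, 3, 4}" for b t
  proof -
    have "0 \<le> f (Grid t 0, Battery b t) \<and> f (Grid t 0, Battery b t) \<le> max 0 (s b t)"
      "0 \<le> f (Battery b t, Grid t 0) \<and> f (Battery b t, Grid t 0) \<le> max 0 (- s b t)"
      using assms that unfolding is_flow_game_iff times by blast+
    thus ?thesis unfolding net_charge_def by linarith
  qed
  have B: "net_charge f b 1 = f (Battery b 1, Battery b 2)"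
    "net_charge f b 2 = f (Battery b 2, Battery b 3) - f (Battery b 1, Battery b 2)"
    "net_charge f b 3 = f (Battery b 3, Battery b 4) - f (Battery b 2, Battery b 3)"
    "net_charge f b 4 = - f (Battery b 3, Battery b 4)"
    "0 \<le> f (Battery b 1, Battery b 2)" "f (Battery b 1, Battery b 2) \<le> 1"
    "0 \<le> f (Battery b 2, Battery b 3)" "f (Battery b 2, Battery b 3) \<le> 1"
    "0 \<le> f (Battery b 3, Battery b 4)" "f (Battery b 3, Battery b 4) \<le> 1"
    if "b \<in> {0, 1}" for b
  proof -
    have cap: "0 \<le> f (Battery b t, Battery b (Suc t)) \<and> f (Battery b t, Battery b (Suc t)) \<le> 1"
      if "t \<in> {1, 2, 3}" for t
      using assms that \<open>b \<in> {0, 1}\<close> unfolding is_flow_game_iff times by blast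
    have balance: "net_charge f b t = (if t = 4 then 0 else f (Battery b t, Battery b (Suc t))) -
        (if t = 1 then 0 else f (Battery b (t - 1), Battery b t))" if "t \<in> {1, 2, 3, 4}" for t
      using assms that \<open>b \<in> {0, 1}\<close> unfolding is_flow_game_iff times by blast
    have suc: "Suc 1 = 2" "Suc 2 = 3" "Suc 3 = 4" "2 - 1 = (1::nat)" "3 - 1 = (2::nat)" "4 - 1 = (3::nat)"
      by simp_all
    show "net_charge f b 1 = f (Battery b 1, Battery b 2)"
      "net_charge f b 2 = f (Battery b 2, Battery b 3) - f (Battery b 1, Battery b 2)"
      "net_charge f b 3 = f (Battery b 3, Battery b 4) - f (Battery b 2, Battery b 3)"
      "net_charge f b 4 = - f (Battery b 3, Battery b 4)"
      "0 \<le> f (Battery b 1, Battery b 2)" "f (Battery b 1, Battery b 2) \<le> 1"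
      "0 \<le> f (Battery b 2, Battery b 3)" "f (Battery b 2, Battery b 3) \<le> 1"
      "0 \<le> f (Battery b 3, Battery b 4)" "f (Battery b 3, Battery b 4) \<le> 1"
      using cap[of 1, unfolded suc] cap[of 2, unfolded suc] cap[of 3, unfolded suc]
        balance[of 1, unfolded suc] balance[of 2, unfolded suc] balance[of 3, unfolded suc]
        balance[of 4, unfolded suc]
      by simp_all
  qed
  have G: "0 \<le> f (Source, Grid t 0)" "f (Source, Grid t 0) \<le> (if odd t then 1 else 0)"
      "0 \<le> f (Grid t 0, Target)" "f (Grid t 0, Target) \<le> (if odd t then 0 else 1)"
      "f (Source, Grid t 0) = f (Grid t 0, Target) + (net_charge f 0 t + net_charge f 1 t)"
    if "t \<in> {1, 2, 3, 4}" for t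
    using assms that unfolding is_flow_game_iff times by blast+
  have charging: "0 \<le> net_charge f 0 t + net_charge f 1 t" "net_charge f 0 t + net_charge f 1 t \<le> 1"
    "f (Source, Grid t 0) = net_charge f 0 t + net_charge f 1 t" if "t \<in> {1, 3}" for t
  proof -
    have "t \<in> {1, 2, 3, 4}" "odd t" using that by auto
    with G[of t] show "0 \<le> net_charge f 0 t + net_charge f 1 t" "net_charge f 0 t + net_charge f 1 t \<le> 1"
      "f (Source, Grid t 0) = net_charge f 0 t + net_charge f 1 t" by simp_all
  qed
  have discharging: "- 1 \<le> net_charge f 0 t + net_charge f 1 t" "net_charge f 0 t + net_charge f 1 t \<le> 0"
    "f (Source, Grid t 0) = 0" if "t \<in> {2, 4}" for t
  proof -
    have "t \<in> {1, 2, 3, 4}" "\<not> odd t" using that by auto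
    with G[of t] show "- 1 \<le> net_charge f 0 t + net_charge f 1 t" "net_charge f 0 t + net_charge f 1 t \<le> 0"
      "f (Source, Grid t 0) = 0" by simp_all
  qed
  \<comment> \<open>The balances telescope: each prefix sum of net charges is the load of a battery
    edge.\<close>
  have stored: "0 \<le> net_charge f b 1" "net_charge f b 1 \<le> 1"
    "0 \<le> net_charge f b 1 + net_charge f b 2" "net_charge f b 1 + net_charge f b 2 \<le> 1"
    "0 \<le> net_charge f b 1 + net_charge f b 2 + net_charge f b 3"
    "net_charge f b 1 + net_charge f b 2 + net_charge f b 3 \<le> 1"
    "net_charge f b 1 + net_charge f b 2 + net_charge f b 3 + net_charge f b 4 = 0"
    if "b \<in> {0, 1}" for b
    using B[OF that] by linarith+
  have total: "0 \<le> net_charge f 0 1 + net_charge f 1 1" "net_charge f 0 1 + net_charge f 1 1 \<le> 1"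
    "-1 \<le> net_charge f 0 2 + net_charge f 1 2" "net_charge f 0 2 + net_charge f 1 2 \<le> 0"
    "0 \<le> net_charge f 0 3 + net_charge f 1 3" "net_charge f 0 3 + net_charge f 1 3 \<le> 1"
    "-1 \<le> net_charge f 0 4 + net_charge f 1 4" "net_charge f 0 4 + net_charge f 1 4 \<le> 0"
    using charging(1,2)[of 1] charging(1,2)[of 3] discharging(1,2)[of 2] discharging(1,2)[of 4]
    by simp_all
  show "feasible (s 0) (s 1) (net_charge f 0) (net_charge f 1)"
    unfolding feasible_def realizable_def balanced_def
    by (intro conjI ballI total; simp only: bounds stored insert_iff simp_thms)
  show "flow_value (network game) Source f = throughput (net_charge f 0) (net_charge f 1)"
    unfolding flow_value_game times throughput_def
    using charging(3)[of 1] charging(3)[of 3] discharging(3)[of 2] discharging(3)[of 4] by simp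
qed

lemma is_flow_flow_of:
  assumes "feasible (s 0) (s 1) (z 0) (z 1)"
  shows "is_flow (network game) (capacity game s) Source Target (flow_of z)"
proof -
  have prefix: "(\<Sum>i=1..1. z b i) = z b 1" "(\<Sum>i=1..2. z b i) = z b 1 + z b 2"
    "(\<Sum>i=1..3. z b i) = z b 1 + z b 2 + z b 3" for b
    by (simp_all add: eval_nat_numeral)
  have bounds: "min 0 (s b t) \<le> z b t" "z b t \<le> max 0 (s b t)"
    if "b \<in> {0, 1}" "t \<in> {1, 2, 3, 4}" for b t
    using assms that unfolding feasible_def realizable_def by blast+
  have stored: "0 \<le> z b 1" "z b 1 \<le> 1" "0 \<le> z b 1 + z b 2" "z b 1 + z b 2 \<le> 1"
    "0 \<le> z b 1 + z b 2 + z b 3" "z b 1 + z b 2 + z b 3 \<le> 1"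
    "z b 1 + z b 2 + z b 3 + z b 4 = 0" if "b \<in> {0, 1}" for b
    using assms that unfolding feasible_def realizable_def by blast+
  have total: "0 \<le> z 0 1 + z 1 1" "z 0 1 + z 1 1 \<le> 1"
    "-1 \<le> z 0 2 + z 1 2" "z 0 2 + z 1 2 \<le> 0"
    "0 \<le> z 0 3 + z 1 3" "z 0 3 + z 1 3 \<le> 1"
    "-1 \<le> z 0 4 + z 1 4" "z 0 4 + z 1 4 \<le> 0"
    using assms unfolding feasible_def balanced_def by blast+
  have "\<forall>b\<in>{0, 1}. \<forall>t\<in>{1, 2, 3}. 0 \<le> (\<Sum>i=1..t. z b i) \<and> (\<Sum>i=1..t. z b i) \<le> 1"
  proof (intro ballI)
    fix b t :: nat
    assume b: "b \<in> {0, 1}" and "t \<in> {1, 2, 3}"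
    then consider "t = 1" | "t = 2" | "t = 3" by blast
    thus "0 \<le> (\<Sum>i=1..t. z b i) \<and> (\<Sum>i=1..t. z b i) \<le> 1"
      by cases (simp_all only: prefix stored[OF b])
  qed
  moreover have "\<forall>b\<in>{0, 1}. \<forall>t\<in>{1, 2, 3, 4}. 0 \<le> max 0 (z b t) \<and> max 0 (z b t) \<le> max 0 (s b t)"
    using bounds(2) by (meson max.cobounded1 max.bounded_iff)
  moreover have "\<forall>b\<in>{0, 1}. \<forall>t\<in>{1, 2, 3, 4}. 0 \<le> max 0 (- z b t) \<and> max 0 (- z b t) \<le> max 0 (- s b t)"
  proof (intro ballI)
    fix b t :: nat
    assume "b \<in> {0, 1}" and "t \<in> {1, 2, 3, 4}"
    from bounds(1)[OF this] show "0 \<le> max 0 (- z b t) \<and> max 0 (- z b t) \<le> max 0 (- s b t)"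
      by linarith
  qed
  moreover have "\<forall>t\<in>{1, 2, 3, 4}. 0 \<le> (if odd t then z 0 t + z 1 t else 0) \<and>
      (if odd t then z 0 t + z 1 t else 0) \<le> (if odd t then 1 else 0)"
    using total by simp
  moreover have "\<forall>t\<in>{1, 2, 3, 4}. 0 \<le> (if odd t then 0 else - z 0 t - z 1 t) \<and>
      (if odd t then 0 else - z 0 t - z 1 t) \<le> (if odd t then 0 else 1)"
    using total by simp
  moreover have "\<forall>t\<in>{1, 2, 3, 4}. (if odd t then z 0 t + z 1 t else 0) =
      (if odd t then 0 else - z 0 t - z 1 t) + (z 0 t + z 1 t)"
    by simp
  moreover have "\<forall>b\<in>{0, 1}. \<forall>t\<in>{1, 2, 3, 4}. z b t =
      (if t = 4 then 0 else \<Sum>i=1..t. z b i) - (if t = 1 then 0 else \<Sum>i=1..t - 1. z b i)"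
  proof (intro ballI)
    fix b t :: nat
    assume b: "b \<in> {0, 1}" and "t \<in> {1, 2, 3, 4}"
    then consider "t = 1" | "t = 2" | "t = 3" | "t = 4" by blast
    thus "z b t = (if t = 4 then 0 else \<Sum>i=1..t. z b i) - (if t = 1 then 0 else \<Sum>i=1..t - 1. z b i)"
      using stored(7)[OF b] by cases (simp_all add: eval_nat_numeral)
  qed
  ultimately show ?thesis
    unfolding is_flow_game_iff times net_charge_flow_of flow_of.simps
    by (intro conjI)
qed

section \<open>Maximum flows and admissibility in terms of net charges\<close>

definition optimal :: "(nat \<Rightarrow> real) \<Rightarrow> (nat \<Rightarrow> real) \<Rightarrow> (nat \<Rightarrow> real) \<Rightarrow> (nat \<Rightarrow> real) \<Rightarrow> bool" where
  "optimal a c x y \<longleftrightarrow> feasible a c x y \<and>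
     (\<forall>x' y'. feasible a c x' y' \<longrightarrow> throughput x' y' \<le> throughput x y)"

text \<open>Only the agent with strategy \<open>a\<close> has to be saturated. The net charges
  \<open>y\<close> may fall short of \<open>c\<close>, so a deviation may displace the other
  agent.\<close>

definition enforced :: "(nat \<Rightarrow> real) \<Rightarrow> (nat \<Rightarrow> real) \<Rightarrow> bool" where
  "enforced a c \<longleftrightarrow> (\<forall>x y. optimal a c x y \<longrightarrow> (\<forall>t\<in>{1, 2, 3, 4}. x t = a t))"

lemma feasible_commute: "feasible a c x y \<longleftrightarrow> feasible c a y x"
  unfolding feasible_def balanced_def by (auto simp: add.commute)

lemma throughput_commute: "throughput x y = throughput y x"
  unfolding throughput_def by simp

lemma optimal_commute: "optimal a c x y \<longleftrightarrow> optimal c a y x"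
  unfolding optimal_def by (metis feasible_commute throughput_commute)

lemma is_max_flow_imp_optimal:
  assumes "is_max_flow (network game) (capacity game s) Source Target f"
  shows "optimal (s 0) (s 1) (net_charge f 0) (net_charge f 1)"
  unfolding optimal_def
proof (intro conjI allI impI)
  show "feasible (s 0) (s 1) (net_charge f 0) (net_charge f 1)"
    using assms unfolding is_max_flow_def by (blast intro: feasible_net_charge(1))
  fix x y assume "feasible (s 0) (s 1) x y"
  hence flow: "is_flow (network game) (capacity game s) Source Target (flow_of (\<lambda>b. if b = 0 then x else y))"
    by (intro is_flow_flow_of) simp
  from feasible_net_charge(2)[OF flow]
  have "flow_value (network game) Source (flow_of (\<lambda>b. if b = 0 then x else y)) = throughput x y"
    by (simp add: net_charge_flow_of throughput_def)
  thus "throughput x y \<le> throughput (net_charge f 0) (net_charge f 1)"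
    using assms flow feasible_net_charge(2)[of s f] unfolding is_max_flow_def by metis
qed

lemma optimal_imp_is_max_flow:
  assumes "optimal (s 0) (s 1) (z 0) (z 1)"
  shows "is_max_flow (network game) (capacity game s) Source Target (flow_of z)"
proof -
  have flow: "is_flow (network game) (capacity game s) Source Target (flow_of z)"
    using assms is_flow_flow_of unfolding optimal_def by blast
  from feasible_net_charge(2)[OF flow]
  have "flow_value (network game) Source (flow_of z) = throughput (z 0) (z 1)"
    by (simp add: net_charge_flow_of throughput_def)
  moreover have "flow_value (network game) Source g \<le> throughput (z 0) (z 1)"
    if "is_flow (network game) (capacity game s) Source Target g" for g
    using assms feasible_net_charge[OF that] unfolding optimal_def by metis
  ultimately show ?thesis
    using flow unfolding is_max_flow_def by simp
qed

lemma optimal_exists: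
  obtains x y where "optimal a c x y"
proof -
  define s where "s b = (if b = 0 then a else c)" for b :: nat
  have fin: "finite (parcs (network game))"
    unfolding parcs_network_game by simp
  have "0 \<le> capacity game s e" if "e \<in> parcs (network game)" for e
    using that unfolding parcs_network_game by (auto simp: capacity_game simp del: capacity.simps)
  with fin obtain f where "is_max_flow (network game) (capacity game s) Source Target f"
    by (rule max_flow_exists)
  from is_max_flow_imp_optimal[OF this] have "optimal a c (net_charge f 0) (net_charge f 1)"
    by (simp add: s_def)
  thus ?thesis by (rule that)
qed

text \<open>Of the two transaction edges of a step, one has capacity 0 and the other the absolute
  value of \<open>s b t\<close>, so saturating both means that the net charge is
  \<open>s b t\<close>. The other agent is \<open>1 - b\<close>.\<close>

lemma admissible_game_iff:
  assumes b: "b \<in> {0, 1}"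
  shows "admissible game s b \<longleftrightarrow> enforced (s b) (s (1 - b))"
proof -
  let ?max = "is_max_flow (network game) (capacity game s) Source Target"
  have saturated: "f (charge_edge game b t) = capacity game s (charge_edge game b t) \<and>
      f (discharge_edge game b t) = capacity game s (discharge_edge game b t) \<longleftrightarrow> net_charge f b t = s b t"
    if "?max f" "t \<in> {1, 2, 3, 4}" for f t
  proof -
    have "0 \<le> f (Grid t 0, Battery b t)" "f (Grid t 0, Battery b t) \<le> max 0 (s b t)"
      "0 \<le> f (Battery b t, Grid t 0)" "f (Battery b t, Grid t 0) \<le> max 0 (- s b t)"
      using that b unfolding is_max_flow_def is_flow_game_iff times by blast+
    moreover have "charge_edge game b t = (Grid t 0, Battery b t)"
      "discharge_edge game b t = (Battery b t, Grid t 0)"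
      by (simp_all add: charge_edge_def discharge_edge_def game_def)
    ultimately show ?thesis
      unfolding net_charge_def by auto
  qed
  have "horizon game = 4" by (simp add: game_def)
  hence edges: "transaction_edges game b = (\<Union>t\<in>{1, 2, 3, 4}. {charge_edge game b t, discharge_edge game b t})"
    unfolding transaction_edges_def by (simp only: times)
  show ?thesis
  proof
    assume adm: "admissible game s b"
    show "enforced (s b) (s (1 - b))"
      unfolding enforced_def
    proof (intro allI impI ballI)
      fix x y :: "nat \<Rightarrow> real" and t :: nat
      assume opt: "optimal (s b) (s (1 - b)) x y" and t: "t \<in> {1, 2, 3, 4}"
      define z where "z i = (if i = b then x else y)" for i
      have "optimal (s 0) (s 1) (z 0) (z 1)"
        using b opt opt[THEN optimal_commute[THEN iffD1]] by (auto simp: z_def)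
      from optimal_imp_is_max_flow[OF this] have max: "?max (flow_of z)" .
      have "charge_edge game b t \<in> transaction_edges game b"
        "discharge_edge game b t \<in> transaction_edges game b"
        unfolding edges using t by blast+
      with adm max saturated[OF max t] have "net_charge (flow_of z) b t = s b t"
        unfolding admissible_def admissible_edge_def by simp
      thus "x t = s b t"
        by (simp add: net_charge_flow_of z_def)
    qed
  next
    assume enf: "enforced (s b) (s (1 - b))"
    have "f e = capacity game s e" if max: "?max f" and "e \<in> transaction_edges game b" for e f
    proof -
      from that(2) obtain t where t: "t \<in> {1, 2, 3, 4}"
        and e: "e = charge_edge game b t \<or> e = discharge_edge game b t"
        unfolding edges by blast
      have "optimal (s b) (s (1 - b)) (net_charge f b) (net_charge f (1 - b))"
        using b is_max_flow_imp_optimal[OF max]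
          is_max_flow_imp_optimal[OF max, THEN optimal_commute[THEN iffD1]] by auto
      with enf t have "net_charge f b t = s b t"
        unfolding enforced_def by blast
      with saturated[OF max t] e show ?thesis by blast
    qed
    thus "admissible game s b"
      unfolding admissible_def admissible_edge_def by blast
  qed
qed

section \<open>Equilibrium conditions\<close>

text \<open>Steps start at 1, so the first list entry is a placeholder. The price at step 1 is 0,
  hence \<open>profit\<close> has no term for that step.\<close>

definition price :: "nat \<Rightarrow> real" where
  "price t = [0, 0, 4, 6, 5] ! t"

definition profit :: "(nat \<Rightarrow> real) \<Rightarrow> real" where
  "profit a = - (4 * a 2 + 6 * a 3 + 5 * a 4)"

lemma utility_game:
  "utility game price s b = (if admissible game s b then ereal (profit (s b)) else - \<infinity>)"
proof -
  have "horizon game = 4" by (simp add: game_def)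
  hence "(\<Sum>t=1..horizon game. s b t * price t) = (\<Sum>t\<in>{1, 2, 3, 4}. s b t * price t)"
    by (simp only: times)
  also have "\<dots> = 4 * s b 2 + 6 * s b 3 + 5 * s b 4"
    by (simp add: price_def)
  finally show ?thesis
    unfolding utility_def profit_def by simp
qed

text \<open>\<open>realizable x x\<close> describes the strategies that also end with an empty
  battery; the deviations used below are all of this kind.\<close>

lemma realizable_imp_strategy:
  assumes "realizable x x"
  shows "strategy game b x"
proof -
  have "0 \<le> sum x {1..t} \<and> sum x {1..t} \<le> 1" if "t \<in> {1, 2, 3}" for t
  proof -
    have "sum x {1..1} = x 1" "sum x {1..2} = x 1 + x 2" "sum x {1..3} = x 1 + x 2 + x 3"
      by (simp_all add: eval_nat_numeral)
    with assms that show ?thesis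
      unfolding realizable_def by auto
  qed
  moreover have "horizon game = 4" "battery_cap game b t = 1" for t
    by (simp_all add: game_def)
  ultimately show ?thesis
    unfolding strategy_def by (metis times(2))
qed

text \<open>Idling is always admissible and has finite utility, which rules out inadmissible
  strategies in an equilibrium. Utilities of admissible strategies are then compared as real
  profits.\<close>

lemma nash_equilibrium_imp:
  assumes nash: "nash_equilibrium game price s" and b: "b \<in> {0, 1}"
  shows "enforced (s b) (s (1 - b))"
    and "realizable x x \<Longrightarrow> enforced x (s (1 - b)) \<Longrightarrow> profit x \<le> profit (s b)"
proof -
  have no_gain: "utility game price (s(b := x)) b \<le> utility game price s b" if "realizable x x" for x
    using nash b realizable_imp_strategy[OF that] unfolding nash_equilibrium_def
    by (force simp: game_def not_less)
  have other: "(s(b := x)) (1 - b) = s (1 - b)" for x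
    using b by auto
  have "realizable (\<lambda>_. 0) (\<lambda>_. 0)"
    by (simp add: realizable_def)
  \<comment> \<open>The sign bounds of the zero strategy leave no net charge but 0.\<close>
  moreover have "enforced (\<lambda>_. 0) (s (1 - b))"
    unfolding enforced_def optimal_def feasible_def realizable_def by auto
  ultimately have "admissible game s b"
    using no_gain[of "\<lambda>_. 0"] admissible_game_iff[OF b, of "s(b := (\<lambda>_. 0))", unfolded other]
    unfolding utility_game by (auto split: if_splits)
  thus "enforced (s b) (s (1 - b))"
    using admissible_game_iff[OF b] by blast
  show "profit x \<le> profit (s b)" if "realizable x x" "enforced x (s (1 - b))"
    using no_gain[OF that(1)] that(2) \<open>admissible game s b\<close>
      admissible_game_iff[OF b, of "s(b := x)", unfolded other]
    unfolding utility_game by (auto split: if_splits)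
qed

section \<open>Rigid profiles and the exclusion of relays\<close>

text \<open>This form is easy to refute: one feasible pair of no smaller throughput with a different
  first component suffices.\<close>

definition rigid :: "(nat \<Rightarrow> real) \<Rightarrow> (nat \<Rightarrow> real) \<Rightarrow> bool" where
  "rigid a c \<longleftrightarrow> feasible a c a c \<and> (\<forall>x y. feasible a c x y \<longrightarrow>
     throughput a c \<le> throughput x y \<longrightarrow> (\<forall>t\<in>{1, 2, 3, 4}. x t = a t))"

lemma realizable_iff:
  "realizable a x \<longleftrightarrow>
     min 0 (a 1) \<le> x 1 \<and> x 1 \<le> max 0 (a 1) \<and> min 0 (a 2) \<le> x 2 \<and> x 2 \<le> max 0 (a 2) \<and>
     min 0 (a 3) \<le> x 3 \<and> x 3 \<le> max 0 (a 3) \<and> min 0 (a 4) \<le> x 4 \<and> x 4 \<le> max 0 (a 4) \<and>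
     0 \<le> x 1 \<and> x 1 \<le> 1 \<and>
     0 \<le> x 1 + x 2 \<and> x 1 + x 2 \<le> 1 \<and>
     0 \<le> x 1 + x 2 + x 3 \<and> x 1 + x 2 + x 3 \<le> 1 \<and>
     x 1 + x 2 + x 3 + x 4 = 0"
  unfolding realizable_def by blast

lemma realizable_self_iff:
  "realizable a a \<longleftrightarrow>
     0 \<le> a 1 \<and> a 1 \<le> 1 \<and>
     0 \<le> a 1 + a 2 \<and> a 1 + a 2 \<le> 1 \<and>
     0 \<le> a 1 + a 2 + a 3 \<and> a 1 + a 2 + a 3 \<le> 1 \<and>
     a 1 + a 2 + a 3 + a 4 = 0"
  unfolding realizable_def by auto

lemma realizable_signD:
  assumes "realizable a x" "t \<in> {1, 2, 3, 4}"
  shows "0 \<le> a t \<Longrightarrow> 0 \<le> x t \<and> x t \<le> a t" and "a t \<le> 0 \<Longrightarrow> a t \<le> x t \<and> x t \<le> 0"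
  using assms unfolding realizable_def by (metis max.absorb1 max.absorb2 min.absorb1 min.absorb2)+

lemma realizable_prefixD:
  assumes "realizable a x"
  shows "0 \<le> x 1" "0 \<le> x 1 + x 2" "x 1 + x 2 + x 3 + x 4 = 0"
  using assms unfolding realizable_def by blast+

lemma realizable_selfD:
  assumes "realizable a a"
  shows "0 \<le> a 1" "a 1 \<le> 1" "0 \<le> a 1 + a 2" "a 1 + a 2 \<le> 1"
    "0 \<le> a 1 + a 2 + a 3" "a 1 + a 2 + a 3 \<le> 1" "a 1 + a 2 + a 3 + a 4 = 0"
  using assms unfolding realizable_self_iff by blast+

lemma balancedD:
  assumes "balanced x y"
  shows "0 \<le> x 1 + y 1" "x 1 + y 1 \<le> 1" "- 1 \<le> x 2 + y 2" "x 2 + y 2 \<le> 0"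
    "0 \<le> x 3 + y 3" "x 3 + y 3 \<le> 1" "- 1 \<le> x 4 + y 4" "x 4 + y 4 \<le> 0"
  using assms unfolding balanced_def by blast+

text \<open>Some optimal pair exists, and mutual enforcement makes it agree with \<open>a\<close>
  and \<open>c\<close> at every step. So the profile is itself feasible and optimal, and every
  feasible pair of at least its throughput is optimal too.\<close>

lemma enforced_imp_rigid:
  assumes "enforced a c" "enforced c a"
  shows "rigid a c"
proof -
  obtain x y where opt: "optimal a c x y" by (rule optimal_exists)
  have "\<forall>t\<in>{1, 2, 3, 4}. x t = a t" "\<forall>t\<in>{1, 2, 3, 4}. y t = c t"
    using assms opt opt[THEN optimal_commute[THEN iffD1]] unfolding enforced_def by blast+
  hence eq: "x 1 = a 1" "x 2 = a 2" "x 3 = a 3" "x 4 = a 4"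
    "y 1 = c 1" "y 2 = c 2" "y 3 = c 3" "y 4 = c 4"
    by simp_all
  have real: "realizable a x" "realizable c y" "balanced x y"
    using opt unfolding optimal_def feasible_def by blast+
  have "realizable a a" "realizable c c"
    using real(1,2) unfolding realizable_self_iff realizable_iff eq by blast+
  moreover have "balanced a c"
    using real(3) unfolding balanced_def eq .
  ultimately have "feasible a c a c"
    unfolding feasible_def by blast
  moreover have "throughput x y = throughput a c"
    unfolding throughput_def eq ..
  moreover from this have "optimal a c x' y'"
    if "feasible a c x' y'" "throughput a c \<le> throughput x' y'" for x' y'
    using opt that unfolding optimal_def by fastforce
  ultimately show ?thesis
    using assms(1) unfolding rigid_def enforced_def by blast
qed

text \<open>
  The energy that agent \<open>a\<close> would relay at step 3 can come from the supply at step 3 instead.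
\<close>

lemma rigid_not_discharging_at_3:
  assumes "rigid a c"
  shows "0 \<le> a 3"
proof (rule ccontr)
  assume neg: "\<not> 0 \<le> a 3"
  have feas: "realizable a a" "realizable c c" "balanced a c"
    using assms unfolding rigid_def feasible_def by blast+
  show False
  proof (cases "0 < a 2")
    case True
    \<comment> \<open>Here some of the energy discharged at step 3 can be taken as charged at step
      2. Cancelling \<open>e\<close> units of this trade keeps later storage unchanged and even
      raises the throughput.\<close>
    define e where "e = min (a 2) (- a 3)"
    define x where "x = a(2 := a 2 - e, 3 := a 3 + e)"
    have x: "x 1 = a 1" "x 2 = a 2 - e" "x 3 = a 3 + e" "x 4 = a 4"
      by (simp_all add: x_def)
    have e: "0 < e" "e \<le> a 2" "e \<le> - a 3"
      using True neg by (simp_all add: e_def)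
    have "realizable a x"
      using realizable_selfD[OF feas(1)] e unfolding realizable_iff x by (intro conjI; linarith)
    moreover have "balanced x c"
      using realizable_selfD[OF feas(1)] realizable_selfD[OF feas(2)] balancedD[OF feas(3)] e
      unfolding balanced_def x by (intro conjI; linarith)
    moreover have "throughput a c \<le> throughput x c"
      using e unfolding throughput_def x by linarith
    ultimately have "x 3 = a 3"
      using assms feas unfolding rigid_def feasible_def by blast
    thus False using e x by simp
  next
    case False
    \<comment> \<open>Now the energy comes from step 1. Carrying \<open>e\<close> units less up to
      step 3 shifts supply from step 1 to step 3 and preserves the throughput.\<close>
    define e where "e = min (a 1) (- a 3)"
    define x where "x = a(1 := a 1 - e, 3 := a 3 + e)"
    have x: "x 1 = a 1 - e" "x 2 = a 2" "x 3 = a 3 + e" "x 4 = a 4"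
      by (simp_all add: x_def)
    have e: "0 < e" "e \<le> a 1" "e \<le> - a 3"
      using False neg feas(1) unfolding e_def realizable_self_iff by linarith+
    have "realizable a x"
      using realizable_selfD[OF feas(1)] e unfolding realizable_iff x by (intro conjI; linarith)
    moreover have "balanced x c"
      using realizable_selfD[OF feas(1)] realizable_selfD[OF feas(2)] balancedD[OF feas(3)] e
      unfolding balanced_def x by (intro conjI; linarith)
    moreover have "throughput a c \<le> throughput x c"
      unfolding throughput_def x by linarith
    ultimately have "x 3 = a 3"
      using assms feas unfolding rigid_def feasible_def by blast
    thus False using e x by simp
  qed
qed

text \<open>
  The energy that agent \<open>a\<close> would relay at step 2 can serve the demand at step 2 instead.
\<close>

lemma rigid_not_charging_at_2:
  assumes "rigid a c" "rigid c a"
  shows "a 2 \<le> 0"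
proof (rule ccontr)
  assume pos: "\<not> a 2 \<le> 0"
  have feas: "realizable a a" "realizable c c" "balanced a c"
    using assms unfolding rigid_def feasible_def by blast+
  have charge: "0 \<le> a 3" "0 \<le> c 3"
    using assms by (auto intro: rigid_not_discharging_at_3)
  \<comment> \<open>Agent \<open>a\<close> skips the charge at step 2 and discharges less at step 4.
    It still discharges there because \<open>a 4 + a 2 = - (a 1 + a 3)\<close> and
    \<open>a 3\<close> is nonnegative.\<close>
  define x where "x = a(2 := 0, 4 := a 4 + a 2)"
  have x: "x 1 = a 1" "x 2 = 0" "x 3 = a 3" "x 4 = a 4 + a 2"
    by (simp_all add: x_def)
  have "a 4 + a 2 \<le> 0"
    using realizable_selfD(1,7)[OF feas(1)] charge(1) by linarith
  moreover have "c 4 \<le> 0"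
    using realizable_selfD(5,7)[OF feas(2)] by linarith
  moreover have "- 1 \<le> c 2"
    using realizable_selfD(1)[OF feas(1)] realizable_selfD(3)[OF feas(2)] balancedD(2)[OF feas(3)]
    by linarith
  ultimately have "balanced x c"
    using balancedD[OF feas(3)] pos unfolding balanced_def x by (intro conjI; linarith)
  moreover have "realizable a x"
    using realizable_selfD[OF feas(1)] pos charge unfolding realizable_iff x by (intro conjI; linarith)

  moreover have "throughput a c \<le> throughput x c"
    unfolding throughput_def x by linarith
  ultimately have "x 2 = a 2"
    using assms feas unfolding rigid_def feasible_def by blast
  thus False using pos x by simp
qed

text \<open>
  Without relays every unit of flow is charged exactly once, so the throughput bounds the charges.
\<close>

lemma enforcedI:
  assumes feas: "realizable a a" "realizable c c" "balanced a c"
    and "a 2 \<le> 0" "c 2 \<le> 0" "0 \<le> a 3" "0 \<le> c 3"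
  shows "enforced a c"
  unfolding enforced_def
proof (intro allI impI)
  fix x y assume opt: "optimal a c x y"
  hence "throughput a c \<le> throughput x y"
    using feas unfolding optimal_def feasible_def by blast
  hence le: "a 1 + c 1 + a 3 + c 3 \<le> x 1 + y 1 + x 3 + y 3"
    unfolding throughput_def .
  have real: "realizable a x" "realizable c y"
    using opt unfolding optimal_def feasible_def by blast+
  have sign: "0 \<le> a 1" "0 \<le> c 1" "a 4 \<le> 0"
    using feas unfolding realizable_self_iff by linarith+
  have x: "x 1 \<le> a 1" "a 2 \<le> x 2" "x 3 \<le> a 3" "a 4 \<le> x 4" "x 1 + x 2 + x 3 + x 4 = 0"
    using realizable_signD[OF real(1)] realizable_prefixD[OF real(1)] assms sign by simp_all
  have y: "y 1 \<le> c 1" "y 3 \<le> c 3"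
    using realizable_signD[OF real(2)] assms sign by simp_all
  have "a 1 + a 2 + a 3 + a 4 = 0"
    using feas unfolding realizable_def by blast
  \<comment> \<open>No charge exceeds its bound, so the throughput forces \<open>x 1 = a 1\<close>
    and \<open>x 3 = a 3\<close>. Both totals are 0 and the discharges are bounded by those of
    \<open>a\<close>, so these agree as well.\<close>
  with le x y have "x 1 = a 1" "x 2 = a 2" "x 3 = a 3" "x 4 = a 4"
    by linarith+
  thus "\<forall>t\<in>{1, 2, 3, 4}. x t = a t"
    by blast
qed

section \<open>Profitable deviations from a rigid profile\<close>

definition stable :: "(nat \<Rightarrow> real) \<Rightarrow> (nat \<Rightarrow> real) \<Rightarrow> bool" where
  "stable a c \<longleftrightarrow> (\<forall>x. realizable x x \<longrightarrow> enforced x c \<longrightarrow> profit x \<le> profit a)"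

text \<open>Buying at price 6 and selling at price 5 loses 1 per unit. Dropping the trade creates no
  relay, so \<open>enforcedI\<close> keeps the deviation admissible.\<close>

lemma stable_idle_at_3:
  assumes "rigid a c" "rigid c a" "stable a c"
  shows "a 3 = 0"
proof -
  have feas: "realizable a a" "realizable c c" "balanced a c"
    using assms unfolding rigid_def feasible_def by blast+
  have signs: "0 \<le> a 3" "0 \<le> c 3" "a 2 \<le> 0" "c 2 \<le> 0"
    using assms by (auto intro: rigid_not_discharging_at_3 rigid_not_charging_at_2)
  define x where "x = a(3 := 0, 4 := a 4 + a 3)"
  have x: "x 1 = a 1" "x 2 = a 2" "x 3 = 0" "x 4 = a 4 + a 3"
    by (simp_all add: x_def)
  have "a 4 + a 3 \<le> 0"
    using realizable_selfD(3,7)[OF feas(1)] by linarith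
  moreover have "c 4 \<le> 0"
    using realizable_selfD(5,7)[OF feas(2)] by linarith
  ultimately have "balanced x c"
    using balancedD[OF feas(3)] signs unfolding balanced_def x by (intro conjI; linarith)
  moreover have "realizable x x"
    using realizable_selfD[OF feas(1)] signs unfolding realizable_self_iff x by (intro conjI; linarith)
  moreover have "x 2 \<le> 0" "0 \<le> x 3"
    using signs unfolding x by simp_all
  ultimately have "realizable x x" "enforced x c"
    using feas signs by (simp_all add: enforcedI)
  hence "profit x \<le> profit a"
    using assms(3) unfolding stable_def by blast
  with signs show ?thesis
    by (simp add: profit_def x)
qed

text \<open>Moving a sale from step 2 to step 4 gains 1 per unit. The demand at step 4 suffices:
  neither agent trades at step 3, so everything sold comes from the single unit supplied at step
  1.\<close>

lemma stable_idle_at_2: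
  assumes "rigid a c" "rigid c a" "stable a c" "stable c a"
  shows "a 2 = 0"
proof -
  have feas: "realizable a a" "realizable c c" "balanced a c"
    using assms unfolding rigid_def feasible_def by blast+
  have signs: "a 3 = 0" "c 3 = 0" "a 2 \<le> 0" "c 2 \<le> 0"
    using assms by (auto intro: stable_idle_at_3 rigid_not_charging_at_2)
  define x where "x = a(2 := 0, 4 := a 4 + a 2)"
  have x: "x 1 = a 1" "x 2 = 0" "x 3 = a 3" "x 4 = a 4 + a 2"
    by (simp_all add: x_def)
  have "a 4 + a 2 = - a 1"
    using realizable_selfD(7)[OF feas(1)] signs(1) by linarith
  moreover have "- c 1 \<le> c 4" "c 4 \<le> 0"
    using realizable_selfD(5,7)[OF feas(2)] signs(2,4) by linarith+
  moreover have "0 \<le> a 1"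
    by (rule realizable_selfD(1)[OF feas(1)])
  moreover have "- 1 \<le> c 2"
    using realizable_selfD(1)[OF feas(1)] realizable_selfD(3)[OF feas(2)] balancedD(2)[OF feas(3)]
    by linarith
  ultimately have "balanced x c"
    using balancedD[OF feas(3)] signs unfolding balanced_def x by (intro conjI; linarith)
  moreover have "realizable x x"
    using realizable_selfD[OF feas(1)] signs unfolding realizable_self_iff x by (intro conjI; linarith)
  moreover have "x 2 \<le> 0" "0 \<le> x 3"
    using signs unfolding x by simp_all
  ultimately have "realizable x x" "enforced x c"
    using feas signs by (simp_all add: enforcedI)
  hence "profit x \<le> profit a"
    using assms(3) unfolding stable_def by blast
  with signs show ?thesis
    by (simp add: profit_def x)
qed

definition alternating :: "nat \<Rightarrow> real" where
  "alternating t = (if odd t then 1 else - 1)"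

lemma realizable_alternating: "realizable alternating alternating"
  by (simp add: realizable_def alternating_def)

lemma enforced_alternating:
  assumes c: "realizable c c" "c 2 = 0" "c 3 = 0"
  shows "enforced alternating c"
  unfolding enforced_def
proof (intro allI impI)
  fix x y assume opt: "optimal alternating c x y"
  \<comment> \<open>With the other agent idle, \<open>alternating\<close> alone ships two units, so
    every optimal pair has throughput at least 2.\<close>
  have "feasible alternating c alternating (\<lambda>_. 0)"
    by (simp add: feasible_def realizable_def balanced_def alternating_def)
  with opt have "throughput alternating (\<lambda>_. 0) \<le> throughput x y"
    unfolding optimal_def by blast
  hence le: "2 \<le> x 1 + y 1 + x 3 + y 3"
    by (simp add: throughput_def alternating_def)
  have real: "realizable alternating x" "realizable c y"
    using opt unfolding optimal_def feasible_def by blast+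
  have x: "x 1 \<le> 1" "- 1 \<le> x 2" "x 3 \<le> 1" "- 1 \<le> x 4"
    "0 \<le> x 1 + x 2" "x 1 + x 2 + x 3 + x 4 = 0"
    using realizable_signD(1)[OF real(1), of 1] realizable_signD(2)[OF real(1), of 2]
      realizable_signD(1)[OF real(1), of 3] realizable_signD(2)[OF real(1), of 4]
      realizable_prefixD[OF real(1)]
    by (simp_all add: alternating_def)
  have y: "y 2 = 0" "y 3 = 0" "y 1 + y 2 + y 3 + y 4 = 0" "0 \<le> y 1"
    using realizable_signD[OF real(2), of 2] realizable_signD[OF real(2), of 3]
      realizable_prefixD[OF real(2)] c
    by simp_all
  have "x 1 + y 1 \<le> 1" "- 1 \<le> x 4 + y 4"
    using opt unfolding optimal_def feasible_def balanced_def by blast+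
  \<comment> \<open>As \<open>y 3 = 0\<close>, throughput 2 forces \<open>x 3 = 1\<close> and
    \<open>x 1 + y 1 = 1\<close>. Since \<open>y 4 = - y 1\<close>, the demand at step 4 gives
    \<open>x 4\<close> at least \<open>y 1 - 1\<close>, so \<open>x 2\<close> is at most -1.
    Discharging that much requires \<open>x 1 = 1\<close>, whence \<open>y 1 = 0\<close>.\<close>
  with le x y have "x 1 = 1" "x 2 = - 1" "x 3 = 1" "x 4 = - 1"
    by linarith+
  thus "\<forall>t\<in>{1, 2, 3, 4}. x t = alternating t"
    by (simp add: alternating_def)
qed

lemma not_stable:
  assumes "rigid a c" "rigid c a" "stable a c" "stable c a"
  shows False
proof -
  have feas: "realizable a a" "realizable c c" "balanced a c"
    using assms unfolding rigid_def feasible_def by blast+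
  have idle: "a 2 = 0" "a 3 = 0" "c 2 = 0" "c 3 = 0"
    using assms by (auto intro: stable_idle_at_2 stable_idle_at_3)
  have "profit alternating \<le> profit a" "profit alternating \<le> profit c"
    using assms(3,4) feas idle enforced_alternating realizable_alternating
    unfolding stable_def by blast+
  \<comment> \<open>The bound 3 is \<open>4 - 6 + 5\<close>, the profit of
    \<open>alternating\<close>. Both agents together would have to earn 6, but the unit demand at
    step 4 yields at most 5.\<close>
  hence "3 \<le> - 5 * a 4" "3 \<le> - 5 * c 4"
    using idle by (simp_all add: profit_def alternating_def)
  moreover have "- 1 \<le> a 4 + c 4"
    using feas(3) unfolding balanced_def by blast
  ultimately show False by linarith
qed

theorem theorem5:
  shows "\<exists>(I :: (nat, nat) battery_instance) (p :: nat \<Rightarrow> real).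
    battery_game I \<and> (\<forall>s. strategy_profile I s \<longrightarrow> \<not> nash_equilibrium I p s)"
proof (intro exI conjI allI impI notI)
  show "battery_game game" by (rule battery_game_game)
  fix s assume nash: "nash_equilibrium game price s"
  have enforced: "enforced (s 0) (s 1)" "enforced (s 1) (s 0)"
    using nash_equilibrium_imp(1)[OF nash, of 0] nash_equilibrium_imp(1)[OF nash, of 1] by simp_all
  have "stable (s 0) (s 1)" "stable (s 1) (s 0)"
    using nash_equilibrium_imp(2)[OF nash, of 0] nash_equilibrium_imp(2)[OF nash, of 1]
    unfolding stable_def by simp_all
  with enforced show False
    by (blast intro: not_stable enforced_imp_rigid)
qed

end
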